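(* Let $(X_t)_{t\ge0}$ be a PDMP with characteristics $(\varphi,(\lambda_i,Q_i)_{i\in\{1,\dots,\ell\}})$ and initial distribution $\mu_0$ given by the construction described in the context from random variables $W_0$ and $((E_{j,k})_{j\in\{1,\dots,\ell\}},U_k)_{k\in\mathbb N^*}$. For all $M>0$, let $(X^M_t)_{t\ge0}$ be the PDMP with characteristics $(\varphi,(M\wedge\lambda_i,Q_i)_{i\in\{1,\dots,\ell\}})$ and initial distribution $\mu_0$ given by the same construction from the same random variables $W_0$ and $((E_{j,k})_{j\in\{1,\dots,\ell\}},U_k)_{k\in\mathbb N^*}$. Then the process $(X_t)_{t\ge0}$ is non-explosive if and only if, for all $t\ge0$, $$\lim_{M\to+\infty}\mathbb P\big(X_s=X_s^M\text{ for all }s\in[0,t]\big)=1.$$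
   Context: $\mathsf M$ is a smooth closed Riemannian submanifold of $\mathbb R^N$ with Borel $\sigma$-field $\mathcal B(\mathsf M)$; $\infty\notin\mathsf M$ is a cemetery point; $\mathcal P(\mathsf M)$ is the set of probability measures on $\mathsf M$; $\inf\emptyset=+\infty$; $\mathbb N^*=\{1,2,\dots\}$. A differential flow on $\mathsf M$ is a measurable map $\varphi:(t,h,x)\mapsto\varphi_{t,t+h}(x)$ from $\mathbb R_+\times\mathbb R_+\times\mathsf M$ to $\mathsf M$ with $\varphi_{t,t}=\mathrm{Id}$, $\varphi_{t+h_1,t+h_1+h_2}\circ\varphi_{t,t+h_1}=\varphi_{t,t+h_1+h_2}$, such that $h\mapsto\varphi_{t,t+h}(x)$ is continuously differentiable for all $(t,x)$ and $\varphi_{t,t+h}$ is a $C^1$-diffeomorphism of $\mathsf M$ for all $t,h\ge0$. A jump rate is a measurable $\lambda:\mathbb R_+\times\mathsf M\to\mathbb R_+$ bounded on every compact subset of $\mathbb R_+\times\mathsf M$; an (inhomogeneous) Markov kernel is $Q:\mathbb R_+\times\mathsf M\times\mathcal B(\mathsf M)\to[0,1]$ with $(t,x)\mapsto Q(t,x,A)$ measurable and $Q(t,x,\cdot)\in\mathcal P(\mathsf M)$. PDMP characteristics $(\varphi,(\lambda_i,Q_i)_{i\in\{1,\dots,\ell\}})$ consist of a flow, jump rates and Markov kernels. For each $i$ a representation $G_i$ of $Q_i$ is fixed: $G_i:\mathbb R_+\times\mathsf M\times[0,1]\to\mathsf M$ measurable with $Q_i(t,x,A)=\mathbb P(G_i(t,x,U)\in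 A)$ for $U$ uniform on $[0,1]$. Construction. $W_0\sim\mu_0$ and, independently, $((E_{j,k})_{j\in\{1,\dots,\ell\}},U_k)_{k\in\mathbb N^*}$ is i.i.d. in $k$, with $U_k$ uniform on $[0,1]$, $E_{j,k}$ exponential with parameter $1$, all independent. Set $S_0=0$, $X_0=X_0'=W_0$. Given $X'_k\in\mathsf M$, $S_k<\infty$, set $S_{j,k+1}=\inf\{t\ge S_k: E_{j,k+1}<\int_{S_k}^t\lambda_j(s,\varphi_{S_k,s}(X_k'))\,ds\}$ and $S_{k+1}=\min_jS_{j,k+1}$. If $S_{k+1}=+\infty$, set $S_m=+\infty$, $X'_m=\infty$ for all $m>k$ and $X_t=\varphi_{S_k,t}(X_k')$ for all $t\ge S_k$. If $S_{k+1}<+\infty$, set $I_{k+1}=\min\{j:S_{j,k+1}=S_{k+1}\}$, $X'_{k+1}=G_{I_{k+1}}(S_{k+1},\varphi_{S_k,S_{k+1}}(X'_k),U_{k+1})$, $X_t=\varphi_{S_k,t}(X'_k)$ for $t\in(S_k,S_{k+1})$ and $X_{S_{k+1}}=X'_{k+1}$. For $t\ge\sup_kS_k$, set $X_t=\infty$. The process is non-explosive if its explosion time $\inf\{t\ge0:X_t=\infty\}$ is $+\infty$ almost surely. *)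

theory Defs
  imports "HOL-Probability.Probability"
begin

text \<open>Differentiability of order \<open>k\<close>; meant for open \<open>S\<close> in a finite-dimensional space, where
  \<open>C\<^sup>k\<^sup>+\<^sup>1\<close> amounts to differentiability together with \<open>C\<^sup>k\<close> directional derivatives in every
  fixed direction.\<close>

primrec C_diff :: "nat \<Rightarrow> 'a::euclidean_space set \<Rightarrow> ('a \<Rightarrow> 'b::euclidean_space) \<Rightarrow> bool" where
  "C_diff 0 S f \<longleftrightarrow> continuous_on S f"
| "C_diff (Suc k) S f \<longleftrightarrow>
     (\<exists>f'. (\<forall>x\<in>S. (f has_derivative f' x) (at x)) \<and> (\<forall>v. C_diff k S (\<lambda>x. f' x v)))"

definition smooth_submanifold :: "'a::euclidean_space set \<Rightarrow> bool" where
  "smooth_submanifold M \<longleftrightarrow>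
     (\<exists>d. \<forall>x\<in>M. \<exists>U V L \<psi> \<psi>'.
        open U \<and> x \<in> U \<and> open V \<and> subspace L \<and> dim L = d \<and>
        homeomorphism U V \<psi> \<psi>' \<and> (\<forall>k. C_diff k U \<psi>) \<and> (\<forall>k. C_diff k V \<psi>') \<and>
        \<psi> ` (U \<inter> M) = V \<inter> (L :: 'a set))"

definition C1_map_on :: "'a::euclidean_space set \<Rightarrow> ('a \<Rightarrow> 'a) \<Rightarrow> bool" where
  "C1_map_on M f \<longleftrightarrow>
     (\<forall>x\<in>M. \<exists>V g. open V \<and> x \<in> V \<and> C_diff 1 V g \<and> (\<forall>y\<in>V \<inter> M. g y = f y))"

definition C1_diffeomorphism_of :: "'a::euclidean_space set \<Rightarrow> ('a \<Rightarrow> 'a) \<Rightarrow> bool" where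
  "C1_diffeomorphism_of M f \<longleftrightarrow>
     bij_betw f M M \<and> C1_map_on M f \<and> C1_map_on M (inv_into M f)"

abbreviation borel_on :: "'a::topological_space set \<Rightarrow> 'a measure" where
  "borel_on S \<equiv> restrict_space borel S"

text \<open>\<open>\<phi> s t x\<close> is the position at time \<open>t\<close> of the flow started from \<open>x\<close> at time \<open>s\<close>; it is
  relevant for \<open>0 \<le> s \<le> t\<close> only, hence the one-sided derivative at \<open>h = 0\<close>.\<close>

definition differential_flow ::
    "'a::euclidean_space set \<Rightarrow> (real \<Rightarrow> real \<Rightarrow> 'a \<Rightarrow> 'a) \<Rightarrow> bool" where
  "differential_flow M \<phi> \<longleftrightarrow>
     (\<lambda>(t, h, x). \<phi> t (t + h) x) \<in> borel_on ({0..} \<times> {0..} \<times> M) \<rightarrow>\<^sub>M borel_on M \<and>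
     (\<forall>t\<ge>0. \<forall>x\<in>M. \<phi> t t x = x) \<and>
     (\<forall>t\<ge>0. \<forall>h1\<ge>0. \<forall>h2\<ge>0. \<forall>x\<in>M.
        \<phi> (t + h1) (t + h1 + h2) (\<phi> t (t + h1) x) = \<phi> t (t + h1 + h2) x) \<and>
     (\<forall>t\<ge>0. \<forall>x\<in>M. \<exists>D. continuous_on {0..} D \<and>
        (\<forall>h\<ge>0. ((\<lambda>h. \<phi> t (t + h) x) has_vector_derivative D h) (at h within {0..}))) \<and>
     (\<forall>t\<ge>0. \<forall>h\<ge>0. C1_diffeomorphism_of M (\<phi> t (t + h)))"

definition jump_rate :: "'a::euclidean_space set \<Rightarrow> (real \<Rightarrow> 'a \<Rightarrow> real) \<Rightarrow> bool" where
  "jump_rate M r \<longleftrightarrow>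
     (\<lambda>(t, x). r t x) \<in> borel_measurable (borel_on ({0..} \<times> M)) \<and>
     (\<forall>t\<ge>0. \<forall>x\<in>M. 0 \<le> r t x) \<and>
     (\<forall>C. compact C \<and> C \<subseteq> {0..} \<times> M \<longrightarrow> bounded ((\<lambda>(t, x). r t x) ` C))"

definition markov_kernel :: "'a::euclidean_space set \<Rightarrow> (real \<Rightarrow> 'a \<Rightarrow> 'a measure) \<Rightarrow> bool" where
  "markov_kernel M Q \<longleftrightarrow>
     (\<forall>t\<ge>0. \<forall>x\<in>M. Q t x \<in> space (prob_algebra (borel_on M))) \<and>
     (\<forall>A\<in>sets (borel_on M).
        (\<lambda>(t, x). measure (Q t x) A) \<in> borel_measurable (borel_on ({0..} \<times> M)))"

definition pdmp_characteristics ::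
    "'a::euclidean_space set \<Rightarrow> (real \<Rightarrow> real \<Rightarrow> 'a \<Rightarrow> 'a) \<Rightarrow> nat \<Rightarrow>
     (nat \<Rightarrow> real \<Rightarrow> 'a \<Rightarrow> real) \<Rightarrow> (nat \<Rightarrow> real \<Rightarrow> 'a \<Rightarrow> 'a measure) \<Rightarrow> bool" where
  "pdmp_characteristics M \<phi> l r Q \<longleftrightarrow>
     differential_flow M \<phi> \<and> (\<forall>i\<in>{1..l}. jump_rate M (r i) \<and> markov_kernel M (Q i))"

definition kernel_representation ::
    "'a::euclidean_space set \<Rightarrow> (real \<Rightarrow> 'a \<Rightarrow> 'a measure) \<Rightarrow> (real \<Rightarrow> 'a \<Rightarrow> real \<Rightarrow> 'a) \<Rightarrow> bool" where
  "kernel_representation M Q G \<longleftrightarrow>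
     (\<lambda>(t, x, u). G t x u) \<in> borel_on ({0..} \<times> M \<times> {0..1}) \<rightarrow>\<^sub>M borel_on M \<and>
     (\<forall>t\<ge>0. \<forall>x\<in>M. \<forall>A\<in>sets (borel_on M).
        measure (Q t x) A = measure (uniform_measure lborel {0..1}) {u\<in>{0..1}. G t x u \<in> A})"

text \<open>The driving variables have values in different spaces, so their mutual independence is
  expressed through the \<open>\<sigma>\<close>-algebras they generate.  Membership of the initial point in \<open>M\<close> and
  of the marks in \<open>[0,1]\<close> holds at every sample point, not merely almost surely.\<close>

datatype source = Initial | Clock nat nat | Mark nat

definition pdmp_inputs ::
    "'a::euclidean_space set \<Rightarrow> nat \<Rightarrow> 'w measure \<Rightarrow> 'a measure \<Rightarrow>
     ('w \<Rightarrow> 'a) \<Rightarrow> (nat \<Rightarrow> nat \<Rightarrow> 'w \<Rightarrow> real) \<Rightarrow> (nat \<Rightarrow> 'w \<Rightarrow> real) \<Rightarrow> bool" where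
  "pdmp_inputs M l P \<mu>0 W E U \<longleftrightarrow>
     prob_space P \<and>
     W \<in> P \<rightarrow>\<^sub>M borel_on M \<and> distr P (borel_on M) W = \<mu>0 \<and>
     (\<forall>j\<in>{1..l}. \<forall>k\<ge>1. distributed P lborel (E j k) (exponential_density 1)) \<and>
     (\<forall>k\<ge>1. U k \<in> P \<rightarrow>\<^sub>M borel_on {0..1} \<and>
        distr P lborel (U k) = uniform_measure lborel {0..1}) \<and>
     prob_space.indep_sets P
       (\<lambda>src. case src of
          Initial \<Rightarrow> sets (vimage_algebra (space P) W (borel_on M))
        | Clock j k \<Rightarrow> sets (vimage_algebra (space P) (E j k) borel)
        | Mark k \<Rightarrow> sets (vimage_algebra (space P) (U k) (borel_on {0..1})))
       ({Initial} \<union> {Clock j k | j k. j \<in> {1..l} \<and> 1 \<le> k} \<union> {Mark k | k. 1 \<le> k})"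

text \<open>The construction below is deterministic in a realisation \<open>w\<close>, \<open>e\<close>, \<open>u\<close> of the driving
  variables.  The cemetery point is \<open>None\<close>.\<close>

definition next_clock ::
    "(real \<Rightarrow> real \<Rightarrow> 'a::euclidean_space \<Rightarrow> 'a) \<Rightarrow> (real \<Rightarrow> 'a \<Rightarrow> real) \<Rightarrow>
     real \<Rightarrow> 'a \<Rightarrow> real \<Rightarrow> ereal" where
  "next_clock \<phi> r a x e =
     Inf (ereal ` {t. a \<le> t \<and> e < (LINT s:{a..t}|lborel. r s (\<phi> a s x))})"

text \<open>\<open>pdmp_chain \<phi> l r G w e u k\<close> is the pair \<open>(S\<^sub>k, X'\<^sub>k)\<close>.\<close>

primrec pdmp_chain ::
    "(real \<Rightarrow> real \<Rightarrow> 'a::euclidean_space \<Rightarrow> 'a) \<Rightarrow> nat \<Rightarrow> (nat \<Rightarrow> real \<Rightarrow> 'a \<Rightarrow> real) \<Rightarrow>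
     (nat \<Rightarrow> real \<Rightarrow> 'a \<Rightarrow> real \<Rightarrow> 'a) \<Rightarrow>
     'a \<Rightarrow> (nat \<Rightarrow> nat \<Rightarrow> real) \<Rightarrow> (nat \<Rightarrow> real) \<Rightarrow> nat \<Rightarrow> ereal \<times> 'a option" where
  "pdmp_chain \<phi> l r G w e u 0 = (0, Some w)"
| "pdmp_chain \<phi> l r G w e u (Suc k) =
     (case pdmp_chain \<phi> l r G w e u k of
        (S, None) \<Rightarrow> (\<infinity>, None)
      | (S, Some x) \<Rightarrow>
          (let a = real_of_ereal S;
               T = (\<lambda>j. next_clock \<phi> (r j) a x (e j (Suc k)));
               S' = (INF j\<in>{1..l}. T j)
           in if S' = \<infinity> then (\<infinity>, None)
              else let b = real_of_ereal S';
                       i = (LEAST j. j \<in> {1..l} \<and> T j = S')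
                   in (S', Some (G i b (\<phi> a b x) (u (Suc k))))))"

text \<open>The jump times are nondecreasing from \<open>S\<^sub>0 = 0\<close>, so for \<open>0 \<le> t < sup\<^sub>k S\<^sub>k\<close> exactly one
  interval \<open>[S\<^sub>n, S\<^sub>n\<^sub>+\<^sub>1)\<close> contains \<open>t\<close>.  At its left endpoint the flow returns \<open>X'\<^sub>n\<close>.\<close>

definition pdmp_path ::
    "(real \<Rightarrow> real \<Rightarrow> 'a::euclidean_space \<Rightarrow> 'a) \<Rightarrow> nat \<Rightarrow> (nat \<Rightarrow> real \<Rightarrow> 'a \<Rightarrow> real) \<Rightarrow>
     (nat \<Rightarrow> real \<Rightarrow> 'a \<Rightarrow> real \<Rightarrow> 'a) \<Rightarrow>
     'a \<Rightarrow> (nat \<Rightarrow> nat \<Rightarrow> real) \<Rightarrow> (nat \<Rightarrow> real) \<Rightarrow> real \<Rightarrow> 'a option" where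
  "pdmp_path \<phi> l r G w e u t =
     (let S = (\<lambda>k. fst (pdmp_chain \<phi> l r G w e u k));
          X' = (\<lambda>k. snd (pdmp_chain \<phi> l r G w e u k))
      in if (SUP k. S k) \<le> ereal t then None
         else let n = (THE n. S n \<le> ereal t \<and> ereal t < S (Suc n))
              in map_option (\<phi> (real_of_ereal (S n)) t) (X' n))"

definition pdmp ::
    "(real \<Rightarrow> real \<Rightarrow> 'a::euclidean_space \<Rightarrow> 'a) \<Rightarrow> nat \<Rightarrow> (nat \<Rightarrow> real \<Rightarrow> 'a \<Rightarrow> real) \<Rightarrow>
     (nat \<Rightarrow> real \<Rightarrow> 'a \<Rightarrow> real \<Rightarrow> 'a) \<Rightarrow>
     ('w \<Rightarrow> 'a) \<Rightarrow> (nat \<Rightarrow> nat \<Rightarrow> 'w \<Rightarrow> real) \<Rightarrow> (nat \<Rightarrow> 'w \<Rightarrow> real) \<Rightarrow> real \<Rightarrow> 'w \<Rightarrow> 'a option" where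
  "pdmp \<phi> l r G W E U t \<omega> = pdmp_path \<phi> l r G (W \<omega>) (\<lambda>j k. E j k \<omega>) (\<lambda>k. U k \<omega>) t"

definition explosion_time :: "(real \<Rightarrow> 'w \<Rightarrow> 'a option) \<Rightarrow> 'w \<Rightarrow> ereal" where
  "explosion_time X \<omega> = Inf (ereal ` {t. 0 \<le> t \<and> X t \<omega> = None})"

definition non_explosive :: "'w measure \<Rightarrow> (real \<Rightarrow> 'w \<Rightarrow> 'a option) \<Rightarrow> bool" where
  "non_explosive P X \<longleftrightarrow> (AE \<omega> in P. explosion_time X \<omega> = \<infinity>)"

end

theory Submission
  imports Defs
begin

text \<open>If a trajectory has not exploded by time \<open>t\<close>, it has made finitely many jumps on \<open>[0,t]\<close>,
  and the rates are bounded along each of the finitely many flow arcs followed up to the last of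
  them; hence for large \<open>K\<close> truncating the rates at \<open>K\<close> does not alter the trajectory on
  \<open>[0,t]\<close> (after the last jump, truncation can only delay the clocks).  By dominated convergence,
  non-explosion implies convergence of the probabilities.  Conversely, a process with
  rates bounded by \<open>K\<close> waits at least \<open>1/K\<close> in every round whose clocks all exceed 1; almost surely
  there are infinitely many such rounds, so it does not explode, and neither does a process
  agreeing with it up to time \<open>t\<close> explode by time \<open>t\<close>.

  The agreement event involves uncountably many times.  It is measurable because every path is
  right-continuous (with an isolated cemetery point), which reduces the event to rational times.\<close>

section \<open>Flows and jump clocks\<close>

lemma flow_in:
  assumes "differential_flow M \<phi>" "0 \<le> s" "s \<le> t" "x \<in> M"
  shows "\<phi> s t x \<in> M"
proof -
  have "(\<lambda>(t, h, x). \<phi> t (t + h) x) \<in> borel_on ({0..} \<times> {0..} \<times> M) \<rightarrow>\<^sub>M borel_on M"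
    using assms(1) by (simp add: differential_flow_def)
  from measurable_space[OF this, of "(s, t - s, x)"] assms(2-) show ?thesis
    by (simp add: space_restrict_space)
qed

lemma continuous_on_flow:
  assumes "differential_flow M \<phi>" "0 \<le> s" "x \<in> M"
  shows "continuous_on {s..} (\<lambda>t. \<phi> s t x)"
proof -
  have "\<forall>t\<ge>0. \<forall>x\<in>M. \<exists>D. continuous_on {0..} D \<and>
      (\<forall>h\<ge>0. ((\<lambda>h. \<phi> t (t + h) x) has_vector_derivative D h) (at h within {0..}))"
    using assms(1) by (simp add: differential_flow_def)
  then obtain D where
    "\<forall>h\<ge>0. ((\<lambda>h. \<phi> s (s + h) x) has_vector_derivative D h) (at h within {0..})"
    using assms(2,3) by meson
  then have "continuous_on {0..} (\<lambda>h. \<phi> s (s + h) x)"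
    by (auto simp: continuous_on_eq_continuous_within intro: has_vector_derivative_continuous)
  then have "continuous_on {s..} ((\<lambda>h. \<phi> s (s + h) x) \<circ> (\<lambda>t. t - s))"
    by (intro continuous_on_compose continuous_intros) (auto elim: continuous_on_subset)
  then show ?thesis
    by (simp add: o_def)
qed

lemma measurable_flow:
  assumes flow: "differential_flow M \<phi>"
    and [measurable]: "\<alpha> \<in> borel_measurable N" "\<beta> \<in> borel_measurable N"
    and X: "X \<in> N \<rightarrow>\<^sub>M borel_on M"
    and le: "\<And>\<omega>. \<omega> \<in> space N \<Longrightarrow> 0 \<le> \<alpha> \<omega>" "\<And>\<omega>. \<omega> \<in> space N \<Longrightarrow> \<alpha> \<omega> \<le> \<beta> \<omega>"
  shows "(\<lambda>\<omega>. \<phi> (\<alpha> \<omega>) (\<beta> \<omega>) (X \<omega>)) \<in> N \<rightarrow>\<^sub>M borel_on M"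
proof -
  have [measurable]: "X \<in> borel_measurable N" and XM: "\<And>\<omega>. \<omega> \<in> space N \<Longrightarrow> X \<omega> \<in> M"
    using X by (auto simp: measurable_restrict_space2_iff)
  have "(\<lambda>\<omega>. (\<alpha> \<omega>, \<beta> \<omega> - \<alpha> \<omega>, X \<omega>)) \<in> N \<rightarrow>\<^sub>M borel_on ({0..} \<times> {0..} \<times> M)"
    using le XM by (intro measurable_restrict_space2 borel_measurable_Pair) auto
  moreover have "(\<lambda>(t, h, x). \<phi> t (t + h) x) \<in> borel_on ({0..} \<times> {0..} \<times> M) \<rightarrow>\<^sub>M borel_on M"
    using flow by (simp add: differential_flow_def)
  ultimately show ?thesis
    by (auto dest: measurable_compose)
qed

lemma measurable_rate:
  assumes rate: "jump_rate M \<rho>"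
    and [measurable]: "\<beta> \<in> borel_measurable N" and X: "X \<in> N \<rightarrow>\<^sub>M borel_on M"
    and le: "\<And>\<omega>. \<omega> \<in> space N \<Longrightarrow> 0 \<le> \<beta> \<omega>"
  shows "(\<lambda>\<omega>. \<rho> (\<beta> \<omega>) (X \<omega>)) \<in> borel_measurable N"
proof -
  have [measurable]: "X \<in> borel_measurable N" and XM: "\<And>\<omega>. \<omega> \<in> space N \<Longrightarrow> X \<omega> \<in> M"
    using X by (auto simp: measurable_restrict_space2_iff)
  have "(\<lambda>\<omega>. (\<beta> \<omega>, X \<omega>)) \<in> N \<rightarrow>\<^sub>M borel_on ({0..} \<times> M)"
    using le XM by (intro measurable_restrict_space2 borel_measurable_Pair) auto
  moreover have "(\<lambda>(t, x). \<rho> t x) \<in> borel_measurable (borel_on ({0..} \<times> M))"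
    using rate by (simp add: jump_rate_def)
  ultimately show ?thesis
    by (auto dest: measurable_compose)
qed

lemma measurable_jump:
  fixes M :: "'a::euclidean_space set" and \<beta> :: "'w \<Rightarrow> real"
  assumes jump: "(\<lambda>(t, x, u). g t x u) \<in> borel_on ({0..} \<times> M \<times> {0..1}) \<rightarrow>\<^sub>M borel_on M"
    and [measurable]: "\<beta> \<in> borel_measurable N" and X: "X \<in> N \<rightarrow>\<^sub>M borel_on M"
    and V: "V \<in> N \<rightarrow>\<^sub>M borel_on {0..1::real}"
    and le: "\<And>\<omega>. \<omega> \<in> space N \<Longrightarrow> 0 \<le> \<beta> \<omega>"
  shows "(\<lambda>\<omega>. g (\<beta> \<omega>) (X \<omega>) (V \<omega>)) \<in> N \<rightarrow>\<^sub>M borel_on M"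
proof -
  have [measurable]: "X \<in> borel_measurable N" "V \<in> borel_measurable N"
    and XM: "\<And>\<omega>. \<omega> \<in> space N \<Longrightarrow> X \<omega> \<in> M" "\<And>\<omega>. \<omega> \<in> space N \<Longrightarrow> V \<omega> \<in> {0..1}"
    using X V by (auto simp: measurable_restrict_space2_iff)
  have "(\<lambda>\<omega>. (\<beta> \<omega>, X \<omega>, V \<omega>)) \<in> borel_measurable N"
    by (intro borel_measurable_Pair) measurable
  then have "(\<lambda>\<omega>. (\<beta> \<omega>, X \<omega>, V \<omega>)) \<in> N \<rightarrow>\<^sub>M borel_on ({0..} \<times> M \<times> {0..1})"
    using le XM by (intro measurable_restrict_space2) auto
  from measurable_compose[OF this jump] show ?thesis
    by auto
qed

lemma jump_rate_min:
  assumes "jump_rate M \<rho>" "0 \<le> K"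
  shows "jump_rate M (\<lambda>t x. min K (\<rho> t x))"
proof -
  have [measurable]: "(\<lambda>(t, x). \<rho> t x) \<in> borel_measurable (borel_on ({0..} \<times> M))"
    and nn: "\<And>t x. 0 \<le> t \<Longrightarrow> x \<in> M \<Longrightarrow> 0 \<le> \<rho> t x"
    using assms by (auto simp: jump_rate_def)
  have "(\<lambda>z. min K ((\<lambda>(t, x). \<rho> t x) z)) \<in> borel_measurable (borel_on ({0..} \<times> M))"
    by measurable
  moreover have "bounded ((\<lambda>(t, x). min K (\<rho> t x)) ` C)" if "C \<subseteq> {0..} \<times> M" for C
  proof (rule boundedI[where B = K])
    fix y assume "y \<in> (\<lambda>(t, x). min K (\<rho> t x)) ` C"
    then obtain t x where tx: "y = min K (\<rho> t x)" "(t, x) \<in> C"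
      by auto
    then have "0 \<le> \<rho> t x"
      using nn that by auto
    with tx(1) assms(2) show "norm y \<le> K"
      by auto
  qed
  ultimately show ?thesis
    using assms(2) nn unfolding jump_rate_def by (simp add: case_prod_unfold)
qed

lemma rate_bounded_along_flow:
  assumes "differential_flow M \<phi>" "jump_rate M \<rho>" "0 \<le> a" "x \<in> M"
  shows "\<exists>C. \<forall>s\<in>{a..t}. \<rho> s (\<phi> a s x) \<le> C"
proof -
  have "continuous_on {a..t} (\<lambda>s. (s, \<phi> a s x))"
    using continuous_on_flow[OF assms(1,3,4)]
    by (intro continuous_intros) (auto elim: continuous_on_subset)
  then have "compact ((\<lambda>s. (s, \<phi> a s x)) ` {a..t})"
    by (intro compact_continuous_image) auto
  moreover have "(\<lambda>s. (s, \<phi> a s x)) ` {a..t} \<subseteq> {0..} \<times> M"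
    using assms(3) flow_in[OF assms(1,3) _ assms(4)] by auto
  moreover have "\<forall>C. compact C \<and> C \<subseteq> {0..} \<times> M \<longrightarrow> bounded ((\<lambda>(t, x). \<rho> t x) ` C)"
    using assms(2) by (simp add: jump_rate_def)
  ultimately have "bounded ((\<lambda>(t, x). \<rho> t x) ` (\<lambda>s. (s, \<phi> a s x)) ` {a..t})"
    by meson
  then obtain C where "\<forall>s\<in>{a..t}. \<bar>\<rho> s (\<phi> a s x)\<bar> \<le> C"
    by (auto simp: bounded_iff)
  then show ?thesis
    by (intro exI[of _ C]) force
qed

lemma rate_integrable_along_flow:
  assumes "differential_flow M \<phi>" "jump_rate M \<rho>" "0 \<le> a" "x \<in> M"
  shows "set_integrable lborel {a..t} (\<lambda>s. \<rho> s (\<phi> a s x))"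
proof -
  obtain C where C: "\<forall>s\<in>{a..t}. \<rho> s (\<phi> a s x) \<le> C"
    using rate_bounded_along_flow[OF assms] by blast
  have const: "(\<lambda>_. x) \<in> borel \<rightarrow>\<^sub>M borel_on M"
    using assms(4) by (auto simp: measurable_restrict_space2_iff)
  have [measurable]: "(\<lambda>s. \<rho> (max a s) (\<phi> a (max a s) x)) \<in> borel_measurable borel"
    by (intro measurable_rate[OF assms(2)] measurable_flow[OF assms(1)] const) (use assms in auto)
  have "set_integrable lborel {a..t} (\<lambda>s. \<rho> (max a s) (\<phi> a (max a s) x))"
    unfolding set_integrable_def
  proof (rule Bochner_Integration.integrable_bound[of _ "\<lambda>s. indicator {a..t} s *\<^sub>R max 0 C"])
    show "AE s in lborel. norm (indicat_real {a..t} s *\<^sub>R \<rho> (max a s) (\<phi> a (max a s) x))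
       \<le> norm (indicat_real {a..t} s *\<^sub>R max 0 C)"
    proof (rule AE_I2)
      fix s
      have "0 \<le> \<rho> s (\<phi> a s x)" "\<rho> s (\<phi> a s x) \<le> C" if "a \<le> s" "s \<le> t"
        using that assms C flow_in[OF assms(1,3) that(1) assms(4)] by (auto simp: jump_rate_def)
      then show "norm (indicat_real {a..t} s *\<^sub>R \<rho> (max a s) (\<phi> a (max a s) x))
         \<le> norm (indicat_real {a..t} s *\<^sub>R max 0 C)"
        by (force simp: indicator_def max_def)
    qed
    show "integrable lborel (\<lambda>s. indicat_real {a..t} s *\<^sub>R max 0 C)"
      using borel_integrable_atLeastAtMost'[of a t "\<lambda>_. max 0 C"] by (simp add: set_integrable_def)
  qed simp
  then show ?thesis
    by (rule iffD1[OF set_integrable_cong, rotated -1]) auto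
qed

lemma hazard_mono:
  assumes "differential_flow M \<phi>" "jump_rate M \<rho>" "0 \<le> a" "x \<in> M" "t \<le> t'"
  shows "(LINT s:{a..t}|lborel. \<rho> s (\<phi> a s x)) \<le> (LINT s:{a..t'}|lborel. \<rho> s (\<phi> a s x))"
  unfolding set_lebesgue_integral_def
proof (rule integral_mono)
  show "integrable lborel (\<lambda>s. indicat_real {a..t} s *\<^sub>R \<rho> s (\<phi> a s x))"
    "integrable lborel (\<lambda>s. indicat_real {a..t'} s *\<^sub>R \<rho> s (\<phi> a s x))"
    using rate_integrable_along_flow[OF assms(1-4)] by (auto simp: set_integrable_def)
  show "indicat_real {a..t} s *\<^sub>R \<rho> s (\<phi> a s x) \<le> indicat_real {a..t'} s *\<^sub>R \<rho> s (\<phi> a s x)" for s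
    using assms flow_in[OF assms(1,3) _ assms(4)] by (auto simp: indicator_def jump_rate_def)
qed

lemma measurable_hazard:
  assumes flow: "differential_flow M \<phi>" and rate: "jump_rate M \<rho>"
    and [measurable]: "\<alpha> \<in> borel_measurable N" and X: "X \<in> N \<rightarrow>\<^sub>M borel_on M"
    and le: "\<And>\<omega>. \<omega> \<in> space N \<Longrightarrow> 0 \<le> \<alpha> \<omega>"
  shows "(\<lambda>\<omega>. LINT s:{\<alpha> \<omega>..t}|lborel. \<rho> s (\<phi> (\<alpha> \<omega>) s (X \<omega>))) \<in> borel_measurable N"
proof -
  have [measurable]: "(\<lambda>z. X (fst z)) \<in> N \<Otimes>\<^sub>M lborel \<rightarrow>\<^sub>M borel_on M"
    using X by measurable
  have [measurable]: "(\<lambda>z. \<rho> (max (\<alpha> (fst z)) (snd z))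
      (\<phi> (\<alpha> (fst z)) (max (\<alpha> (fst z)) (snd z)) (X (fst z)))) \<in> borel_measurable (N \<Otimes>\<^sub>M lborel)"
    by (intro measurable_rate[OF rate] measurable_flow[OF flow])
      (auto simp: space_pair_measure le max.coboundedI1)
  have "(\<lambda>\<omega>. \<integral>s. (if \<alpha> \<omega> \<le> s \<and> s \<le> t
        then \<rho> (max (\<alpha> \<omega>) s) (\<phi> (\<alpha> \<omega>) (max (\<alpha> \<omega>) s) (X \<omega>)) else 0) \<partial>lborel)
      \<in> borel_measurable N"
    by (rule lborel.borel_measurable_lebesgue_integral) (unfold case_prod_unfold, measurable)
  also have "(\<lambda>\<omega>. \<integral>s. (if \<alpha> \<omega> \<le> s \<and> s \<le> t
        then \<rho> (max (\<alpha> \<omega>) s) (\<phi> (\<alpha> \<omega>) (max (\<alpha> \<omega>) s) (X \<omega>)) else 0) \<partial>lborel)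
      = (\<lambda>\<omega>. LINT s:{\<alpha> \<omega>..t}|lborel. \<rho> s (\<phi> (\<alpha> \<omega>) s (X \<omega>)))"
    unfolding set_lebesgue_integral_def
    by (intro ext Bochner_Integration.integral_cong) (auto simp: indicator_def max_def)
  finally show ?thesis .
qed

lemma next_clock_ge: "ereal a \<le> next_clock \<phi> \<rho> a x \<epsilon>"
  by (auto simp: next_clock_def intro!: Inf_greatest)

lemma next_clock_less_iff:
  "next_clock \<phi> \<rho> a x \<epsilon> < c \<longleftrightarrow>
     (\<exists>t\<ge>a. ereal t < c \<and> \<epsilon> < (LINT s:{a..t}|lborel. \<rho> s (\<phi> a s x)))"
  by (auto simp: next_clock_def Inf_less_iff)

lemma measurable_next_clock:
  assumes flow: "differential_flow M \<phi>" and rate: "jump_rate M \<rho>"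
    and [measurable]: "\<alpha> \<in> borel_measurable N" "\<epsilon> \<in> borel_measurable N"
    and X: "X \<in> N \<rightarrow>\<^sub>M borel_on M"
    and le: "\<And>\<omega>. \<omega> \<in> space N \<Longrightarrow> 0 \<le> \<alpha> \<omega>"
  shows "(\<lambda>\<omega>. next_clock \<phi> \<rho> (\<alpha> \<omega>) (X \<omega>) (\<epsilon> \<omega>)) \<in> borel_measurable N"
proof (rule borel_measurableI_less)
  fix c :: ereal
  note [measurable] = measurable_hazard[OF flow rate _ X le]
  have "{\<omega> \<in> space N. next_clock \<phi> \<rho> (\<alpha> \<omega>) (X \<omega>) (\<epsilon> \<omega>) < c} =
    {\<omega> \<in> space N. \<exists>q::rat. \<alpha> \<omega> \<le> of_rat q \<and> ereal (of_rat q) < c \<and>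
       \<epsilon> \<omega> < (LINT s:{\<alpha> \<omega>..of_rat q}|lborel. \<rho> s (\<phi> (\<alpha> \<omega>) s (X \<omega>)))}"
    (is "?A = ?B")
  proof
    show "?B \<subseteq> ?A"
      by (auto simp: next_clock_less_iff)
    show "?A \<subseteq> ?B"
    proof clarsimp
      fix \<omega> assume \<omega>: "\<omega> \<in> space N" "next_clock \<phi> \<rho> (\<alpha> \<omega>) (X \<omega>) (\<epsilon> \<omega>) < c"
      then obtain t where t: "\<alpha> \<omega> \<le> t" "ereal t < c"
          "\<epsilon> \<omega> < (LINT s:{\<alpha> \<omega>..t}|lborel. \<rho> s (\<phi> (\<alpha> \<omega>) s (X \<omega>)))"
        by (auto simp: next_clock_less_iff)
      obtain t' where t': "t < t'" "ereal t' < c"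
        using ereal_dense2[OF t(2)] by auto
      then obtain q where q: "t < of_rat q" "of_rat q < t'"
        using of_rat_dense by blast
      have "X \<omega> \<in> M"
        using measurable_space[OF X \<omega>(1)] by (simp add: space_restrict_space)
      from hazard_mono[OF flow rate le[OF \<omega>(1)] this, of t "of_rat q"] t t' q
      show "\<exists>q. \<alpha> \<omega> \<le> of_rat q \<and> ereal (of_rat q) < c \<and>
         \<epsilon> \<omega> < (LINT s:{\<alpha> \<omega>..of_rat q}|lborel. \<rho> s (\<phi> (\<alpha> \<omega>) s (X \<omega>)))"
        by (intro exI[of _ q]) (auto intro: less_le_trans less_trans[of _ "ereal t'"])
    qed
  qed
  also have "?B \<in> sets N"
    by measurable
  finally show "{\<omega> \<in> space N. next_clock \<phi> \<rho> (\<alpha> \<omega>) (X \<omega>) (\<epsilon> \<omega>) < c} \<in> sets N" .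
qed

lemma next_clock_antimono:
  assumes flow: "differential_flow M \<phi>" and "jump_rate M \<rho>" "jump_rate M \<rho>'"
    and a: "0 \<le> a" "x \<in> M" and le: "\<And>t x. 0 \<le> t \<Longrightarrow> x \<in> M \<Longrightarrow> \<rho> t x \<le> \<rho>' t x"
  shows "next_clock \<phi> \<rho>' a x \<epsilon> \<le> next_clock \<phi> \<rho> a x \<epsilon>"
proof -
  have "(LINT s:{a..t}|lborel. \<rho> s (\<phi> a s x)) \<le> (LINT s:{a..t}|lborel. \<rho>' s (\<phi> a s x))" for t
    using a by (intro set_integral_mono rate_integrable_along_flow[OF flow] assms le flow_in[OF flow]) auto
  then show ?thesis
    unfolding next_clock_def by (intro Inf_superset_mono) (auto intro: less_le_trans)
qed

lemma next_clock_le_cong: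
  assumes "\<And>s. a \<le> s \<Longrightarrow> s \<le> c \<Longrightarrow> \<rho>' s (\<phi> a s x) = \<rho> s (\<phi> a s x)"
    and "next_clock \<phi> \<rho> a x \<epsilon> < ereal c"
  shows "next_clock \<phi> \<rho>' a x \<epsilon> \<le> next_clock \<phi> \<rho> a x \<epsilon>"
proof (rule dense_ge)
  fix y assume "next_clock \<phi> \<rho> a x \<epsilon> < y"
  with assms(2) have "next_clock \<phi> \<rho> a x \<epsilon> < min y (ereal c)"
    by simp
  then obtain t where t: "a \<le> t" "ereal t < y" "t < c" "\<epsilon> < (LINT s:{a..t}|lborel. \<rho> s (\<phi> a s x))"
    unfolding next_clock_less_iff by auto
  moreover have "(LINT s:{a..t}|lborel. \<rho> s (\<phi> a s x)) = (LINT s:{a..t}|lborel. \<rho>' s (\<phi> a s x))"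
    using assms(1) t by (intro set_lebesgue_integral_cong) auto
  ultimately have "next_clock \<phi> \<rho>' a x \<epsilon> < y"
    unfolding next_clock_less_iff by auto
  then show "next_clock \<phi> \<rho>' a x \<epsilon> \<le> y"
    by simp
qed

lemma next_clock_lower_bound:
  assumes flow: "differential_flow M \<phi>" and rate: "jump_rate M \<rho>" and a: "0 \<le> a" "x \<in> M"
    and K: "0 < K" and le: "\<And>t x. 0 \<le> t \<Longrightarrow> x \<in> M \<Longrightarrow> \<rho> t x \<le> K"
  shows "ereal (a + \<epsilon> / K) \<le> next_clock \<phi> \<rho> a x \<epsilon>"
  unfolding next_clock_def
proof (rule Inf_greatest, clarsimp)
  fix t assume t: "a \<le> t" "\<epsilon> < (LINT s:{a..t}|lborel. \<rho> s (\<phi> a s x))"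
  note t(2)
  also have "(LINT s:{a..t}|lborel. \<rho> s (\<phi> a s x)) \<le> (LINT s:{a..t}|lborel. K)"
  proof (rule set_integral_mono)
    show "set_integrable lborel {a..t} (\<lambda>s. \<rho> s (\<phi> a s x))"
      by (rule rate_integrable_along_flow[OF flow rate a])
    show "\<rho> s (\<phi> a s x) \<le> K" if "s \<in> {a..t}" for s
      using that a by (intro le flow_in[OF flow]) auto
  qed (rule borel_integrable_atLeastAtMost', rule continuous_on_const)
  also have "\<dots> = K * (t - a)"
    using t(1) by (simp add: set_lebesgue_integral_def)
  finally show "a + \<epsilon> / K \<le> t"
    using K by (simp add: field_simps)
qed

section \<open>The construction for one realisation of the driving variables\<close>

declare pdmp_chain.simps(2) [simp del]

locale pdmp_data =
  fixes M :: "'a::euclidean_space set"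
    and \<phi> :: "real \<Rightarrow> real \<Rightarrow> 'a \<Rightarrow> 'a"
    and l :: nat
    and r :: "nat \<Rightarrow> real \<Rightarrow> 'a \<Rightarrow> real"
    and G :: "nat \<Rightarrow> real \<Rightarrow> 'a \<Rightarrow> real \<Rightarrow> 'a"
  assumes flow: "differential_flow M \<phi>"
    and rate: "j \<in> {1..l} \<Longrightarrow> jump_rate M (r j)"
    and jump: "j \<in> {1..l} \<Longrightarrow>
      (\<lambda>(t, x, u). G j t x u) \<in> borel_on ({0..} \<times> M \<times> {0..1}) \<rightarrow>\<^sub>M borel_on M"
begin

lemma jump_in:
  assumes "j \<in> {1..l}" "0 \<le> t" "x \<in> M" "u \<in> {0..1}"
  shows "G j t x u \<in> M"
  using measurable_space[OF jump[OF assms(1)], of "(t, x, u)"] assms(2-)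
  by (simp add: space_restrict_space)

lemma truncated: "0 \<le> K \<Longrightarrow> pdmp_data M \<phi> l (\<lambda>i t x. min K (r i t x)) G"
  by (intro pdmp_data.intro flow jump jump_rate_min rate) assumption+

end

locale pdmp_realisation = pdmp_data M \<phi> l r G
  for M :: "'a::euclidean_space set" and \<phi> l r G +
  fixes w :: 'a and e :: "nat \<Rightarrow> nat \<Rightarrow> real" and u :: "nat \<Rightarrow> real"
  assumes w_in: "w \<in> M" and u_in: "1 \<le> k \<Longrightarrow> u k \<in> {0..1}"
begin

abbreviation chain :: "nat \<Rightarrow> ereal \<times> 'a option" where
  "chain \<equiv> pdmp_chain \<phi> l r G w e u"

abbreviation path :: "real \<Rightarrow> 'a option" where
  "path \<equiv> pdmp_path \<phi> l r G w e u"

abbreviation clock :: "real \<Rightarrow> 'a \<Rightarrow> nat \<Rightarrow> nat \<Rightarrow> ereal" where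
  "clock a x k j \<equiv> next_clock \<phi> (r j) a x (e j k)"

lemma truncated_realisation:
  "0 \<le> K \<Longrightarrow> pdmp_realisation M \<phi> l (\<lambda>i t x. min K (r i t x)) G w u"
  using truncated w_in u_in
  by (simp add: pdmp_realisation_def pdmp_realisation_axioms_def)

lemma first_clock:
  assumes "0 \<le> a"
  obtains "(INF j\<in>{1..l}. clock a x k j) = \<infinity>"
  | b where "(INF j\<in>{1..l}. clock a x k j) = ereal b" "a \<le> b"
      "(LEAST j. j \<in> {1..l} \<and> clock a x k j = ereal b) \<in> {1..l}"
      "clock a x k (LEAST j. j \<in> {1..l} \<and> clock a x k j = ereal b) = ereal b"
proof (cases "(INF j\<in>{1..l}. clock a x k j) = \<infinity>")
  case False
  have "ereal a \<le> (INF j\<in>{1..l}. clock a x k j)"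
    by (intro INF_greatest next_clock_ge)
  with False obtain b where b: "(INF j\<in>{1..l}. clock a x k j) = ereal b" "a \<le> b"
    by (cases "INF j\<in>{1..l}. clock a x k j") auto
  have ne: "{1..l} \<noteq> {}"
    using False by (intro notI) (simp add: top_ereal_def)
  then have "(INF j\<in>{1..l}. clock a x k j) \<in> clock a x k ` {1..l}"
    by (subst cInf_eq_Min) (auto intro: Min_in)
  then have "\<exists>j. j \<in> {1..l} \<and> clock a x k j = ereal b"
    using b by auto
  from LeastI_ex[OF this] b that(2) show ?thesis by blast
qed (use that in blast)

lemma chain_Suc_Some:
  assumes "chain k = (ereal a, Some x)"
  defines "S \<equiv> INF j\<in>{1..l}. clock a x (Suc k) j"
  shows "chain (Suc k) = (if S = \<infinity> then (\<infinity>, None)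
    else (S, Some (G (LEAST j. j \<in> {1..l} \<and> clock a x (Suc k) j = S)
      (real_of_ereal S) (\<phi> a (real_of_ereal S) x) (u (Suc k)))))"
  by (subst pdmp_chain.simps(2), subst assms(1))
    (unfold prod.case option.case Let_def real_of_ereal.simps S_def, rule refl)

lemma fst_chain_Suc:
  assumes "chain k = (ereal a, Some x)"
  shows "fst (chain (Suc k)) = (INF j\<in>{1..l}. clock a x (Suc k) j)"
proof (cases "(INF j\<in>{1..l}. clock a x (Suc k) j) = \<infinity>")
  case True
  show ?thesis
    unfolding chain_Suc_Some[OF assms] if_P[OF True] unfolding fst_conv True ..
next
  case False
  show ?thesis
    unfolding chain_Suc_Some[OF assms] if_not_P[OF False] fst_conv ..
qed

lemma chain_Suc_stopped:
  assumes "chain k = (ereal a, Some x)" "(INF j\<in>{1..l}. clock a x (Suc k) j) = \<infinity>"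
  shows "chain (Suc k) = (\<infinity>, None)"
  unfolding chain_Suc_Some[OF assms(1)] using assms(2) by (rule if_P)

lemma chain_Suc_alive:
  assumes "chain k = (ereal a, Some x)" "(INF j\<in>{1..l}. clock a x (Suc k) j) = ereal b"
  shows "chain (Suc k) = (ereal b,
    Some (G (LEAST j. j \<in> {1..l} \<and> clock a x (Suc k) j = ereal b) b (\<phi> a b x) (u (Suc k))))"
  unfolding chain_Suc_Some[OF assms(1)] assms(2) if_not_P[OF PInfty_neq_ereal(1)] real_of_ereal.simps ..

lemma chain_Suc_dead: "chain k = (\<infinity>, None) \<Longrightarrow> chain (Suc k) = (\<infinity>, None)"
  by (subst pdmp_chain.simps(2)) (erule ssubst, unfold prod.case option.case, rule refl)

lemma chain_invariant:
  "chain k = (\<infinity>, None) \<or> (\<exists>a x. chain k = (ereal a, Some x) \<and> 0 \<le> a \<and> x \<in> M)"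
proof (induction k)
  case 0
  then show ?case
    using w_in by (auto simp: zero_ereal_def)
next
  case (Suc k)
  then consider "chain k = (\<infinity>, None)" | a x where "chain k = (ereal a, Some x)" "0 \<le> a" "x \<in> M"
    by blast
  then show ?case
  proof cases
    case 1
    then show ?thesis
      using chain_Suc_dead by simp
  next
    case ax: (2 a x)
    show ?thesis
    proof (cases rule: first_clock[OF ax(2), of x "Suc k"])
      case 1
      then show ?thesis
        using chain_Suc_stopped[OF ax(1)] by simp
    next
      case (2 b)
      have "G (LEAST j. j \<in> {1..l} \<and> clock a x (Suc k) j = ereal b) b (\<phi> a b x) (u (Suc k)) \<in> M"
        using 2 ax by (intro jump_in flow_in[OF flow] u_in) auto
      then show ?thesis
        using chain_Suc_alive[OF ax(1) 2(1)] 2(2) ax(2) by auto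
    qed
  qed
qed

lemma chain_cases [case_names dead alive]:
  obtains "chain k = (\<infinity>, None)"
  | a x where "chain k = (ereal a, Some x)" "0 \<le> a" "x \<in> M"
  using chain_invariant by blast

lemma incseq_jump_times: "incseq (\<lambda>k. fst (chain k))"
proof (rule incseq_SucI)
  fix k show "fst (chain k) \<le> fst (chain (Suc k))"
  proof (cases k rule: chain_cases)
    case (alive a x)
    then show ?thesis
      unfolding fst_chain_Suc[OF alive(1)] by (auto intro!: INF_greatest next_clock_ge)
  qed (simp add: chain_Suc_dead)
qed

lemma jump_times_nonneg: "0 \<le> fst (chain k)"
  by (cases k rule: chain_cases) auto

lemma path_eq_None: "(SUP k. fst (chain k)) \<le> ereal t \<Longrightarrow> path t = None"
  by (simp add: pdmp_path_def)

lemma interval_index: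
  assumes "fst (chain n) \<le> ereal t" "ereal t < fst (chain (Suc n))"
  shows "(THE n. fst (chain n) \<le> ereal t \<and> ereal t < fst (chain (Suc n))) = n"
proof (rule the_equality)
  fix m assume m: "fst (chain m) \<le> ereal t \<and> ereal t < fst (chain (Suc m))"
  have "fst (chain (Suc m)) \<le> ereal t" if "Suc m \<le> n"
    using incseqD[OF incseq_jump_times that] assms(1) by (rule order_trans)
  moreover have "fst (chain (Suc n)) \<le> ereal t" if "Suc n \<le> m"
    using incseqD[OF incseq_jump_times that] conjunct1[OF m] by (rule order_trans)
  ultimately show "m = n"
    using m assms(2) by (meson leD not_less_eq_eq nat_le_linear not_less_eq linorder_neqE_nat Suc_leI)
qed (use assms in auto)

lemma path_eq_Some:
  assumes "chain n = (ereal a, Some x)" "a \<le> t" "ereal t < fst (chain (Suc n))"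
  shows "path t = Some (\<phi> a t x)"
proof -
  have "ereal t < (SUP k. fst (chain k))"
    using assms(3) less_SUP_iff by blast
  moreover have "(THE n. fst (chain n) \<le> ereal t \<and> ereal t < fst (chain (Suc n))) = n"
    using assms by (intro interval_index) auto
  ultimately show ?thesis
    using assms(1) unfolding pdmp_path_def by (simp add: leD)
qed

lemma interval_least:
  assumes "0 \<le> t" "ereal t < (SUP k. fst (chain k))"
  defines "n \<equiv> LEAST n. ereal t < fst (chain (Suc n))"
  shows "fst (chain n) \<le> ereal t" "ereal t < fst (chain (Suc n))"
proof -
  obtain k where k: "ereal t < fst (chain k)"
    using assms(2) by (auto simp: less_SUP_iff)
  with assms(1) have "k \<noteq> 0"
    by (intro notI) simp
  with k have ex: "ereal t < fst (chain (Suc (k - 1)))"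
    by simp
  then show "ereal t < fst (chain (Suc n))"
    unfolding n_def by (rule LeastI)
  show "fst (chain n) \<le> ereal t"
  proof (cases n)
    case (Suc m)
    then have "m < (LEAST n. ereal t < fst (chain (Suc n)))"
      unfolding n_def by simp
    from not_less_Least[OF this] show ?thesis
      unfolding Suc by simp
  qed (use assms(1) in simp)
qed

lemma interval_least_alive:
  assumes "0 \<le> t" "ereal t < (SUP k. fst (chain k))"
  obtains a x where "chain (LEAST n. ereal t < fst (chain (Suc n))) = (ereal a, Some x)"
    "0 \<le> a" "a \<le> t" "x \<in> M" "path t = Some (\<phi> a t x)"
proof -
  define n where "n = (LEAST n. ereal t < fst (chain (Suc n)))"
  note n = interval_least[OF assms, folded n_def]
  then obtain a x where ax: "chain n = (ereal a, Some x)" "0 \<le> a" "x \<in> M"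
    by (cases n rule: chain_cases) auto
  with n have "a \<le> t"
    by simp
  with ax n(2) show ?thesis
    using that[folded n_def] path_eq_Some by blast
qed

lemma path_None_iff:
  assumes "0 \<le> t"
  shows "path t = None \<longleftrightarrow> (SUP k. fst (chain k)) \<le> ereal t"
  using path_eq_None interval_least_alive[OF assms] by (metis not_less option.distinct(1))

lemma explosion_time_eq: "Inf (ereal ` {t. 0 \<le> t \<and> path t = None}) = (SUP k. fst (chain k))"
proof (rule antisym)
  have nn: "0 \<le> (SUP k. fst (chain k))"
    using jump_times_nonneg by (rule SUP_upper2[OF UNIV_I])
  show "Inf (ereal ` {t. 0 \<le> t \<and> path t = None}) \<le> (SUP k. fst (chain k))"
  proof (cases "SUP k. fst (chain k)")
    case (real c)
    then have "c \<in> {t. 0 \<le> t \<and> path t = None}"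
      using nn path_None_iff[of c] by auto
    then show ?thesis
      unfolding real by (intro Inf_lower) blast
  qed (use nn in simp_all)
  show "(SUP k. fst (chain k)) \<le> Inf (ereal ` {t. 0 \<le> t \<and> path t = None})"
    using path_None_iff by (auto intro!: Inf_greatest)
qed

lemma path_right_continuous:
  assumes "0 \<le> s"
  obtains d where "0 < d" "path s = None" "\<And>t. s \<le> t \<Longrightarrow> t < s + d \<Longrightarrow> path t = None"
  | d f where "0 < d" "continuous_on {s..} f" "\<And>t. s \<le> t \<Longrightarrow> t < s + d \<Longrightarrow> path t = Some (f t)"
proof (cases "(SUP k. fst (chain k)) \<le> ereal s")
  case True
  then have "path t = None" if "s \<le> t" for t
    using that by (intro path_eq_None) (auto intro: order_trans)
  then show ?thesis
    using that(1)[of 1] by auto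
next
  case False
  define n where "n = (LEAST n. ereal s < fst (chain (Suc n)))"
  have less: "ereal s < (SUP k. fst (chain k))"
    using False by simp
  obtain a x where ax: "chain n = (ereal a, Some x)" "0 \<le> a" "a \<le> s" "x \<in> M"
    using interval_least_alive[OF assms less] unfolding n_def by metis
  have "ereal s < fst (chain (Suc n))"
    using interval_least[OF assms less] unfolding n_def by simp
  then obtain c where c: "s < c" "ereal c < fst (chain (Suc n))"
    using ereal_dense2[of "ereal s"] by fastforce
  have "continuous_on {s..} (\<lambda>t. \<phi> a t x)"
    using continuous_on_flow[OF flow ax(2,4)] ax(3) by (auto elim: continuous_on_subset)
  moreover have "path t = Some (\<phi> a t x)" if "s \<le> t" "t < s + (c - s)" for t
    using that ax(3) c by (intro path_eq_Some[OF ax(1)]) (auto intro: less_trans[of _ "ereal c"])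
  ultimately show ?thesis
    using that(2)[of "c - s"] c by auto
qed

lemma explosion_free_if_bounded_rates:
  assumes K: "0 < K" "\<And>j t x. j \<in> {1..l} \<Longrightarrow> 0 \<le> t \<Longrightarrow> x \<in> M \<Longrightarrow> r j t x \<le> K"
    and inf: "\<And>n. \<exists>k\<ge>n. \<forall>j\<in>{1..l}. 1 \<le> e j (Suc k)"
  shows "(SUP k. fst (chain k)) = \<infinity>"
proof -
  have "\<exists>k. ereal (real n / K) \<le> fst (chain k)" for n
  proof (induction n)
    case (Suc n)
    then obtain k where k: "ereal (real n / K) \<le> fst (chain k)"
      by blast
    obtain m where m: "k \<le> m" "\<forall>j\<in>{1..l}. 1 \<le> e j (Suc m)"
      using inf by blast
    have km: "ereal (real n / K) \<le> fst (chain m)"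
      using k incseqD[OF incseq_jump_times m(1)] by (rule order_trans)
    have "ereal (real (Suc n) / K) \<le> fst (chain (Suc m))"
    proof (cases m rule: chain_cases)
      case (alive a x)
      show ?thesis
        unfolding fst_chain_Suc[OF alive(1)]
      proof (rule INF_greatest)
        fix j assume j: "j \<in> {1..l}"
        have "1 / K \<le> e j (Suc m) / K"
          using K(1) m(2) j by (intro divide_right_mono) auto
        moreover have "real n / K \<le> a"
          using km alive(1) by simp
        ultimately have "real (Suc n) / K \<le> a + e j (Suc m) / K"
          by (simp add: add_divide_distrib)
        then show "ereal (real (Suc n) / K) \<le> clock a x (Suc m) j"
          using next_clock_lower_bound[OF flow rate[OF j] alive(2,3) K(1) K(2)[OF j]]
          by (meson ereal_less_eq(3) order_trans)
      qed
    qed (use km in \<open>simp add: chain_Suc_dead\<close>)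
    then show ?case
      by blast
  qed (use jump_times_nonneg in \<open>auto simp: zero_ereal_def\<close>)
  then have "ereal (real n / K) \<le> (SUP k. fst (chain k))" for n
    by (meson SUP_upper2 UNIV_I)
  then have "ereal B \<le> (SUP k. fst (chain k))" for B
    using reals_Archimedean2[of "B * K"] K(1)
    by (meson divide_less_eq ereal_less_eq(3) less_divide_eq less_imp_le order_trans)
  then show ?thesis
    by (rule ereal_top)
qed

subsection \<open>Truncation\<close>

lemma chain_truncation:
  assumes "fst (chain n) < \<infinity>"
  shows "\<forall>\<^sub>F K in at_top. \<forall>m\<le>n. pdmp_chain \<phi> l (\<lambda>i t x. min K (r i t x)) G w e u m = chain m"
  using assms
proof (induction n)
  case 0
  show ?case
    by (intro always_eventually allI impI) simp
next
  case (Suc n)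
  have less: "fst (chain n) < \<infinity>"
    using Suc.prems incseqD[OF incseq_jump_times, of n "Suc n"] by auto
  then obtain a x where ax: "chain n = (ereal a, Some x)" "0 \<le> a" "x \<in> M"
    by (cases n rule: chain_cases) auto
  obtain b where b: "(INF j\<in>{1..l}. clock a x (Suc n) j) = ereal b" "a \<le> b"
    "(LEAST j. j \<in> {1..l} \<and> clock a x (Suc n) j = ereal b) \<in> {1..l}"
    "clock a x (Suc n) (LEAST j. j \<in> {1..l} \<and> clock a x (Suc n) j = ereal b) = ereal b"
  proof (cases rule: first_clock[OF ax(2), of x "Suc n"])
    case 1
    then show ?thesis
      using Suc.prems fst_chain_Suc[OF ax(1)] by simp
  next
    case (2 b)
    then show ?thesis
      by (rule that)
  qed
  have "\<forall>j\<in>{1..l}. \<exists>C. \<forall>s\<in>{a..b+1}. r j s (\<phi> a s x) \<le> C"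
    using rate_bounded_along_flow[OF flow rate ax(2,3)] by blast
  then obtain C where C: "\<And>j s. j \<in> {1..l} \<Longrightarrow> s \<in> {a..b+1} \<Longrightarrow> r j s (\<phi> a s x) \<le> C j"
    by metis
  have "\<forall>\<^sub>F K in at_top. \<forall>j\<in>{1..l}. C j \<le> K"
    by (intro eventually_ball_finite) (auto intro: eventually_ge_at_top)
  with Suc.IH[OF less] eventually_ge_at_top[of 0] show ?case
  proof eventually_elim
    case (elim K)
    let ?r = "\<lambda>i t x. min K (r i t x)"
    let ?T = "\<lambda>j. next_clock \<phi> (?r j) a x (e j (Suc n))"
    interpret T: pdmp_realisation M \<phi> l ?r G w e u
      by (rule truncated_realisation) fact
    have ge: "clock a x (Suc n) j \<le> ?T j" if "j \<in> {1..l}" for j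
      using that by (intro next_clock_antimono[OF flow T.rate rate ax(2,3)]) auto
    have eq: "?T j = ereal b" if j: "j \<in> {1..l}" and "clock a x (Suc n) j = ereal b" for j
    proof (rule antisym)
      have "?T j \<le> clock a x (Suc n) j"
      proof (rule next_clock_le_cong[where c = "b + 1"])
        fix s assume "a \<le> s" "s \<le> b + 1"
        then have "r j s (\<phi> a s x) \<le> K"
          using C[OF j, of s] elim(3) j by force
        then show "min K (r j s (\<phi> a s x)) = r j s (\<phi> a s x)"
          by simp
      qed (use that in simp)
      with that show "?T j \<le> ereal b"
        by simp
    qed (use that ge[OF j] in simp)
    have iff: "j \<in> {1..l} \<and> ?T j = ereal b \<longleftrightarrow> j \<in> {1..l} \<and> clock a x (Suc n) j = ereal b" for j
    proof (intro iffI conjI; elim conjE)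
      assume j: "j \<in> {1..l}" "?T j = ereal b"
      have "ereal b \<le> clock a x (Suc n) j"
        unfolding b(1)[symmetric] by (rule INF_lower) fact
      then show "clock a x (Suc n) j = ereal b"
        using ge[OF j(1)] j(2) by simp
    qed (use eq in blast)+
    have inf: "(INF j\<in>{1..l}. ?T j) = ereal b"
    proof (rule antisym)
      show "(INF j\<in>{1..l}. ?T j) \<le> ereal b"
        using INF_lower[OF b(3), of ?T] unfolding eq[OF b(3,4)] .
      show "ereal b \<le> (INF j\<in>{1..l}. ?T j)"
        unfolding b(1)[symmetric] by (intro INF_superset_mono order_refl ge)
    qed
    have "T.chain n = (ereal a, Some x)"
      using elim(1) ax(1) by simp
    from T.chain_Suc_alive[OF this inf] have "T.chain (Suc n) = chain (Suc n)"
      unfolding chain_Suc_alive[OF ax(1) b(1)] iff .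
    then show ?case
      using elim(1) unfolding le_Suc_eq by blast
  qed
qed

lemma path_truncation:
  assumes t: "0 \<le> t" "ereal t < (SUP k. fst (chain k))"
  shows "\<forall>\<^sub>F K in at_top. \<forall>s\<in>{0..t}.
    path s = pdmp_path \<phi> l (\<lambda>i t x. min K (r i t x)) G w e u s"
proof -
  define n where "n = (LEAST n. ereal t < fst (chain (Suc n)))"
  note n = interval_least[OF t, folded n_def]
  have "fst (chain n) < \<infinity>"
    using n(1) by auto
  from chain_truncation[OF this] eventually_ge_at_top[of 0] show ?thesis
  proof eventually_elim
    case (elim K)
    let ?r = "\<lambda>i t x. min K (r i t x)"
    interpret T: pdmp_realisation M \<phi> l ?r G w e u
      by (rule truncated_realisation) fact
    show ?case
    proof
      fix s assume s: "s \<in> {0..t}"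
      define m where "m = (LEAST n. ereal s < fst (chain (Suc n)))"
      have s': "0 \<le> s" "ereal s < (SUP k. fst (chain k))"
        using s t(2) by (auto intro: le_less_trans[of _ "ereal t"])
      obtain a x where ax: "chain m = (ereal a, Some x)" "0 \<le> a" "a \<le> s" "x \<in> M"
          "path s = Some (\<phi> a s x)"
        using interval_least_alive[OF s'] unfolding m_def by metis
      have "m \<le> n"
        unfolding m_def using n(2) s by (intro Least_le) (auto intro: le_less_trans[of _ "ereal t"])
      have "ereal s < fst (chain (Suc m))"
        using interval_least[OF s'] unfolding m_def by simp
      also have "fst (chain (Suc m)) \<le> fst (T.chain (Suc m))"
        unfolding fst_chain_Suc[OF ax(1)]
          T.fst_chain_Suc[OF trans[OF elim(1)[rule_format, OF \<open>m \<le> n\<close>] ax(1)]]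
        by (intro INF_superset_mono order_refl next_clock_antimono[OF flow T.rate rate ax(2,4)]) auto
      finally show "path s = T.path s"
        using T.path_eq_Some[of m a x s] elim(1) \<open>m \<le> n\<close> ax by simp
    qed
  qed
qed

end

lemma paths_equal_iff_on_dense:
  assumes "pdmp_realisation M \<phi> l r G w u" "pdmp_realisation M \<phi> l r' G w u"
  shows "(\<forall>s\<in>{0..t}. pdmp_path \<phi> l r G w e u s = pdmp_path \<phi> l r' G w e u s) \<longleftrightarrow>
    (\<forall>s\<in>{0..t} \<inter> (insert t \<rat>). pdmp_path \<phi> l r G w e u s = pdmp_path \<phi> l r' G w e u s)"
proof (intro iffI ballI)
  interpret A: pdmp_realisation M \<phi> l r G w e u by fact
  interpret B: pdmp_realisation M \<phi> l r' G w e u by fact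
  fix s assume eq: "\<forall>s\<in>{0..t} \<inter> (insert t \<rat>). A.path s = B.path s" and s: "s \<in> {0..t}"
  show "A.path s = B.path s"
  proof (rule ccontr)
    assume ne: "A.path s \<noteq> B.path s"
    have s0: "0 \<le> s" using s by simp
    have st: "s < t"
      using s ne eq by (cases "s = t") auto
    have dense: "\<exists>q. s \<le> q \<and> q < s + d \<and> A.path q = B.path q" if d: "0 < d" for d
    proof -
      obtain q where "q \<in> \<rat>" "s < q" "q < min t (s + d)"
        using Rats_dense_in_real[of s "min t (s + d)"] d st by auto
      then show ?thesis
        using eq s0 by (intro exI[of _ q]) auto
    qed
    have both: False if "0 < d" "0 < d'" "\<And>q. s \<le> q \<Longrightarrow> q < s + d \<Longrightarrow> q < s + d' \<Longrightarrow> A.path q \<noteq> B.path q"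
      for d d'
      using dense[of "min d d'"] that by auto
    show False
    proof (cases rule: A.path_right_continuous[OF s0])
      case A: (1 d)
      show ?thesis
      proof (cases rule: B.path_right_continuous[OF s0])
        case (1 d')
        with A ne show ?thesis by simp
      next
        case (2 d' f)
        with A show ?thesis by (intro both[of d d']) auto
      qed
    next
      case A: (2 d f)
      show ?thesis
      proof (cases rule: B.path_right_continuous[OF s0])
        case (1 d')
        with A show ?thesis by (intro both[of d d']) auto
      next
        case B: (2 d' g)
        have "f s \<noteq> g s"
          using ne A B by auto
        moreover have "continuous_on {s..} (\<lambda>t. f t - g t)"
          using A B by (intro continuous_intros)
        ultimately obtain c where c: "0 < c" "\<And>t. t \<in> {s..} \<Longrightarrow> dist s t < c \<Longrightarrow> f t - g t \<noteq> 0"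
          using continuous_on_avoid[of "{s..}" "\<lambda>t. f t - g t" s 0] by auto
        have "f t \<noteq> g t" if "s \<le> t" "t < s + c" for t
          using c(2)[of t] that by (auto simp: dist_real_def)
        then show ?thesis
          using A B c(1) by (intro both[of "min d d'" c]) auto
      qed
    qed
  qed
qed auto

section \<open>Random driving variables\<close>

locale pdmp_driven = pdmp_data M \<phi> l r G
  for M :: "'a::euclidean_space set" and \<phi> l r G +
  fixes P :: "'w measure" and W :: "'w \<Rightarrow> 'a"
    and E :: "nat \<Rightarrow> nat \<Rightarrow> 'w \<Rightarrow> real" and U :: "nat \<Rightarrow> 'w \<Rightarrow> real"
  assumes W: "W \<in> P \<rightarrow>\<^sub>M borel_on M"
    and E: "j \<in> {1..l} \<Longrightarrow> 1 \<le> k \<Longrightarrow> E j k \<in> borel_measurable P"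
    and U: "1 \<le> k \<Longrightarrow> U k \<in> P \<rightarrow>\<^sub>M borel_on {0..1}"
begin

lemma realisation: "\<omega> \<in> space P \<Longrightarrow> pdmp_realisation M \<phi> l r G (W \<omega>) (\<lambda>k. U k \<omega>)"
  using measurable_space[OF W] measurable_space[OF U]
  by unfold_locales (auto simp: space_restrict_space)

lemma truncated_driven: "0 \<le> K \<Longrightarrow> pdmp_driven M \<phi> l (\<lambda>i t x. min K (r i t x)) G P W E U"
  by (intro pdmp_driven.intro truncated pdmp_driven_axioms.intro W E U)

definition jump_time :: "nat \<Rightarrow> 'w \<Rightarrow> ereal" where
  "jump_time k \<omega> = fst (pdmp_chain \<phi> l r G (W \<omega>) (\<lambda>j k. E j k \<omega>) (\<lambda>k. U k \<omega>) k)"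

text \<open>The cemetery point is represented by the initial point, which keeps the values in \<open>M\<close>.\<close>

definition position :: "nat \<Rightarrow> 'w \<Rightarrow> 'a" where
  "position k \<omega> = (case snd (pdmp_chain \<phi> l r G (W \<omega>) (\<lambda>j k. E j k \<omega>) (\<lambda>k. U k \<omega>) k) of
     None \<Rightarrow> W \<omega> | Some x \<Rightarrow> x)"

definition explosion :: "'w \<Rightarrow> ereal" where
  "explosion \<omega> = (SUP k. jump_time k \<omega>)"

lemma jump_time_nonneg: "\<omega> \<in> space P \<Longrightarrow> 0 \<le> jump_time k \<omega>"
  unfolding jump_time_def by (rule pdmp_realisation.jump_times_nonneg[OF realisation])

lemma measurable_chain: "jump_time k \<in> borel_measurable P \<and> position k \<in> P \<rightarrow>\<^sub>M borel_on M"
proof (induction k)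
  case 0
  have "jump_time 0 = (\<lambda>\<omega>. 0)" "position 0 = W"
    by (auto simp: jump_time_def position_def fun_eq_iff)
  then show ?case
    using W by simp
next
  case (Suc k)
  then have [measurable]: "jump_time k \<in> borel_measurable P" and X: "position k \<in> P \<rightarrow>\<^sub>M borel_on M"
    by auto
  define a where "a \<omega> = real_of_ereal (jump_time k \<omega>)" for \<omega>
  define T where "T j \<omega> = next_clock \<phi> (r j) (a \<omega>) (position k \<omega>) (E j (Suc k) \<omega>)" for j \<omega>
  define I where "I \<omega> = (INF j\<in>{1..l}. T j \<omega>)" for \<omega>
  define i where "i \<omega> = (LEAST j. j \<in> {1..l} \<and> T j \<omega> = I \<omega>)" for \<omega>
  define b where "b \<omega> = max (a \<omega>) (real_of_ereal (I \<omega>))" for \<omega>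
  define J where "J j \<omega> = (if j \<in> {1..l}
    then G j (b \<omega>) (\<phi> (a \<omega>) (b \<omega>) (position k \<omega>)) (U (Suc k) \<omega>) else W \<omega>)" for j \<omega>
  have a_nonneg: "0 \<le> a \<omega>" if "\<omega> \<in> space P" for \<omega>
    unfolding a_def using jump_time_nonneg[OF that] by (rule real_of_ereal_pos)
  have [measurable]: "a \<in> borel_measurable P"
    unfolding a_def by measurable
  have T [measurable]: "T j \<in> borel_measurable P" if "j \<in> {1..l}" for j
    unfolding T_def using that a_nonneg
    by (intro measurable_next_clock[OF flow rate] X E) auto
  have I [measurable]: "I \<in> borel_measurable P"
    unfolding I_def by (rule borel_measurable_INF) (auto intro: T)
  have [measurable]: "b \<in> borel_measurable P"
    unfolding b_def by measurable
  have ab: "0 \<le> b \<omega>" "a \<omega> \<le> b \<omega>" if "\<omega> \<in> space P" for \<omega>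
    using a_nonneg[OF that] by (auto simp: b_def)
  have i: "i \<in> P \<rightarrow>\<^sub>M count_space UNIV"
    unfolding i_def
  proof (rule measurable_Least)
    fix j
    show "Measurable.pred P (\<lambda>\<omega>. j \<in> {1..l} \<and> T j \<omega> = I \<omega>)"
      by (cases "j \<in> {1..l}") (auto intro: T I)
  qed
  have J: "J j \<in> P \<rightarrow>\<^sub>M borel_on M" for j
  proof (cases "j \<in> {1..l}")
    case True
    have "(\<lambda>\<omega>. G j (b \<omega>) (\<phi> (a \<omega>) (b \<omega>) (position k \<omega>)) (U (Suc k) \<omega>)) \<in> P \<rightarrow>\<^sub>M borel_on M"
      by (intro measurable_jump[OF jump[OF True]] measurable_flow[OF flow] X U ab a_nonneg) simp_all
    then show ?thesis
      unfolding J_def using True by simp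
  next
    case False
    have "J j = W"
      unfolding J_def using False by (intro ext if_not_P)
    then show ?thesis
      using W by simp
  qed
  have step: "jump_time (Suc k) \<omega> = (if jump_time k \<omega> = \<infinity> then \<infinity> else I \<omega>) \<and>
      position (Suc k) \<omega> = (if jump_time (Suc k) \<omega> = \<infinity> then W \<omega> else J (i \<omega>) \<omega>)"
    if \<omega>: "\<omega> \<in> space P" for \<omega>
  proof -
    interpret R: pdmp_realisation M \<phi> l r G "W \<omega>" "\<lambda>j k. E j k \<omega>" "\<lambda>k. U k \<omega>"
      by (rule realisation) fact
    show ?thesis
    proof (cases k rule: R.chain_cases)
      case dead
      have "jump_time k \<omega> = \<infinity>" "jump_time (Suc k) \<omega> = \<infinity>" "position (Suc k) \<omega> = W \<omega>"
        unfolding jump_time_def position_def R.chain_Suc_dead[OF dead] dead by simp_all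
      then show ?thesis by simp
    next
      case (alive c x)
      have k: "jump_time k \<omega> = ereal c" "a \<omega> = c" "position k \<omega> = x"
        unfolding a_def jump_time_def position_def alive(1) by simp_all
      have I: "I \<omega> = (INF j\<in>{1..l}. R.clock c x (Suc k) j)"
        unfolding I_def T_def k ..
      show ?thesis
      proof (cases rule: R.first_clock[OF alive(2), of x "Suc k"])
        case 1
        have "jump_time (Suc k) \<omega> = \<infinity>" "position (Suc k) \<omega> = W \<omega>"
          unfolding jump_time_def position_def R.chain_Suc_stopped[OF alive(1) 1] by simp_all
        then show ?thesis
          using I 1 by simp
      next
        case (2 b')
        have I': "I \<omega> = ereal b'"
          using I 2(1) by simp
        have b': "b \<omega> = b'"
          unfolding b_def I' k using 2(2) by simp
        have i': "i \<omega> = (LEAST j. j \<in> {1..l} \<and> R.clock c x (Suc k) j = ereal b')"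
          unfolding i_def T_def I' k ..
        have "J (i \<omega>) \<omega> = G (i \<omega>) b' (\<phi> c b' x) (U (Suc k) \<omega>)"
          unfolding J_def b' k using 2(3) unfolding i' by (rule if_P)
        moreover have "jump_time (Suc k) \<omega> = ereal b'"
          "position (Suc k) \<omega> = G (i \<omega>) b' (\<phi> c b' x) (U (Suc k) \<omega>)"
          unfolding jump_time_def position_def R.chain_Suc_alive[OF alive(1) 2(1)] i' by simp_all
        ultimately show ?thesis
          using I' k(1) by simp
      qed
    qed
  qed
  have S: "jump_time (Suc k) \<in> borel_measurable P"
  proof (subst measurable_cong)
    show "(\<lambda>\<omega>. if jump_time k \<omega> = \<infinity> then \<infinity> else I \<omega>) \<in> borel_measurable P"
      by measurable
  qed (use step in blast)
  have "position (Suc k) \<in> P \<rightarrow>\<^sub>M borel_on M"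
  proof (subst measurable_cong)
    have "(\<lambda>\<omega>. J (i \<omega>) \<omega>) \<in> P \<rightarrow>\<^sub>M borel_on M"
      by (rule measurable_compose_countable[OF J i])
    then show "(\<lambda>\<omega>. if jump_time (Suc k) \<omega> = \<infinity> then W \<omega> else J (i \<omega>) \<omega>) \<in> P \<rightarrow>\<^sub>M borel_on M"
      using W S by (intro measurable_If) auto
  qed (use step in blast)
  with S show ?case
    by blast
qed

lemma measurable_jump_time [measurable]: "jump_time k \<in> borel_measurable P"
  and measurable_position: "position k \<in> P \<rightarrow>\<^sub>M borel_on M"
  using measurable_chain by auto

lemma measurable_explosion [measurable]: "explosion \<in> borel_measurable P"
  unfolding explosion_def by measurable

lemma pdmp_None_iff:
  "\<omega> \<in> space P \<Longrightarrow> 0 \<le> s \<Longrightarrow> pdmp \<phi> l r G W E U s \<omega> = None \<longleftrightarrow> explosion \<omega> \<le> ereal s"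
  unfolding pdmp_def explosion_def jump_time_def
  by (rule pdmp_realisation.path_None_iff[OF realisation])

lemma explosion_time_pdmp: "\<omega> \<in> space P \<Longrightarrow> explosion_time (pdmp \<phi> l r G W E U) \<omega> = explosion \<omega>"
  unfolding explosion_time_def pdmp_def explosion_def jump_time_def
  by (rule pdmp_realisation.explosion_time_eq[OF realisation])

lemma measurable_pdmp_value:
  assumes "0 \<le> s"
  shows "(\<lambda>\<omega>. case pdmp \<phi> l r G W E U s \<omega> of None \<Rightarrow> W \<omega> | Some x \<Rightarrow> x) \<in> P \<rightarrow>\<^sub>M borel_on M"
proof (subst measurable_cong)
  define n where "n \<omega> = (LEAST n. ereal s < jump_time (Suc n) \<omega>)" for \<omega>
  define V where "V m \<omega> = \<phi> (min s (real_of_ereal (jump_time m \<omega>))) s (position m \<omega>)" for m \<omega>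
  have n: "n \<in> P \<rightarrow>\<^sub>M count_space UNIV"
    unfolding n_def by measurable
  have V: "V m \<in> P \<rightarrow>\<^sub>M borel_on M" for m
    unfolding V_def using assms jump_time_nonneg
    by (intro measurable_flow[OF flow] measurable_position) (auto intro: real_of_ereal_pos)
  have "(\<lambda>\<omega>. V (n \<omega>) \<omega>) \<in> P \<rightarrow>\<^sub>M borel_on M"
    by (rule measurable_compose_countable[OF V n])
  then show "(\<lambda>\<omega>. if explosion \<omega> \<le> ereal s then W \<omega> else V (n \<omega>) \<omega>) \<in> P \<rightarrow>\<^sub>M borel_on M"
    using W by (intro measurable_If) auto
  fix \<omega> assume \<omega>: "\<omega> \<in> space P"
  interpret R: pdmp_realisation M \<phi> l r G "W \<omega>" "\<lambda>j k. E j k \<omega>" "\<lambda>k. U k \<omega>"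
    by (rule realisation) fact
  show "(case pdmp \<phi> l r G W E U s \<omega> of None \<Rightarrow> W \<omega> | Some x \<Rightarrow> x) =
    (if explosion \<omega> \<le> ereal s then W \<omega> else V (n \<omega>) \<omega>)"
  proof (cases "explosion \<omega> \<le> ereal s")
    case True
    then show ?thesis
      using pdmp_None_iff[OF \<omega> assms] by simp
  next
    case False
    then have "ereal s < (SUP k. fst (R.chain k))"
      unfolding explosion_def jump_time_def by simp
    from R.interval_least_alive[OF assms this] obtain a x where
      ax: "R.chain (n \<omega>) = (ereal a, Some x)" "a \<le> s" "R.path s = Some (\<phi> a s x)"
      unfolding n_def jump_time_def by metis
    have "V (n \<omega>) \<omega> = \<phi> a s x"
      unfolding V_def jump_time_def position_def ax(1) using ax(2) by (simp add: min_absorb2)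
    then show ?thesis
      using False ax(3) unfolding pdmp_def by simp
  qed
qed

end

lemma sets_pdmp_eq:
  assumes "pdmp_driven M \<phi> l r G P W E U" "pdmp_driven M \<phi> l r' G P W E U"
  shows "{\<omega> \<in> space P. \<forall>s\<in>{0..t}. pdmp \<phi> l r G W E U s \<omega> = pdmp \<phi> l r' G W E U s \<omega>} \<in> sets P"
proof -
  interpret A: pdmp_driven M \<phi> l r G P W E U by fact
  interpret B: pdmp_driven M \<phi> l r' G P W E U by fact
  let ?X = "pdmp \<phi> l r G W E U" and ?Y = "pdmp \<phi> l r' G W E U"
  have pointwise: "Measurable.pred P (\<lambda>\<omega>. ?X s \<omega> = ?Y s \<omega>)" if s: "0 \<le> s" for s
  proof -
    define x where "x \<omega> = (case ?X s \<omega> of None \<Rightarrow> W \<omega> | Some x \<Rightarrow> x)" for \<omega>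
    define y where "y \<omega> = (case ?Y s \<omega> of None \<Rightarrow> W \<omega> | Some x \<Rightarrow> x)" for \<omega>
    have [measurable]: "x \<in> borel_measurable P" "y \<in> borel_measurable P"
      using A.measurable_pdmp_value[OF s] B.measurable_pdmp_value[OF s]
      unfolding x_def y_def by (auto simp: measurable_restrict_space2_iff)
    have eq: "(?X s \<omega> = ?Y s \<omega>) \<longleftrightarrow>
        (A.explosion \<omega> \<le> ereal s \<longleftrightarrow> B.explosion \<omega> \<le> ereal s) \<and> dist (x \<omega>) (y \<omega>) = 0"
      if "\<omega> \<in> space P" for \<omega>
      unfolding A.pdmp_None_iff[OF that s, symmetric] B.pdmp_None_iff[OF that s, symmetric] x_def y_def
      by (cases "?X s \<omega>"; cases "?Y s \<omega>") auto
    show ?thesis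
      by (rule measurable_cong[THEN iffD2, OF eq]) measurable
  qed
  have eq: "(\<forall>s\<in>{0..t}. ?X s \<omega> = ?Y s \<omega>) \<longleftrightarrow> (\<forall>s\<in>{0..t} \<inter> insert t \<rat>. ?X s \<omega> = ?Y s \<omega>)"
    if "\<omega> \<in> space P" for \<omega>
    unfolding pdmp_def by (rule paths_equal_iff_on_dense[OF A.realisation[OF that] B.realisation[OF that]])
  have "Measurable.pred P (\<lambda>\<omega>. \<forall>s\<in>{0..t} \<inter> insert t \<rat>. ?X s \<omega> = ?Y s \<omega>)"
    by (intro measurable_pred_countable pointwise) (auto intro: countable_Int2 countable_rat)
  then have "{\<omega> \<in> space P. \<forall>s\<in>{0..t} \<inter> insert t \<rat>. ?X s \<omega> = ?Y s \<omega>} \<in> sets P"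
    by (rule predE)
  also have "{\<omega> \<in> space P. \<forall>s\<in>{0..t} \<inter> insert t \<rat>. ?X s \<omega> = ?Y s \<omega>} =
      {\<omega> \<in> space P. \<forall>s\<in>{0..t}. ?X s \<omega> = ?Y s \<omega>}"
    using eq by (intro Collect_cong conj_cong refl) (rule sym)
  finally show ?thesis .
qed

lemma pdmp_inputs_driven:
  assumes "pdmp_characteristics M \<phi> l r Q" "\<forall>i\<in>{1..l}. kernel_representation M (Q i) (G i)"
    and "pdmp_inputs M l P \<mu> W E U"
  shows "pdmp_driven M \<phi> l r G P W E U"
proof
  show "E j k \<in> borel_measurable P" if "j \<in> {1..l}" "1 \<le> k" for j k
  proof -
    have "distributed P lborel (E j k) (exponential_density 1)"
      using assms(3) that by (simp add: pdmp_inputs_def)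
    from distributed_measurable[OF this] show ?thesis by simp
  qed
qed (use assms in \<open>auto simp: pdmp_characteristics_def kernel_representation_def pdmp_inputs_def\<close>)

text \<open>The only use of the independence of the driving variables.\<close>

lemma long_clocks_infinitely_often:
  assumes inputs: "pdmp_inputs M l P \<mu> W E U"
  shows "AE \<omega> in P. \<forall>n. \<exists>k\<ge>n. \<forall>j\<in>{1..l}. 1 \<le> E j (Suc k) \<omega>"
proof -
  interpret prob_space P
    using inputs by (simp add: pdmp_inputs_def)
  have exp: "distributed P lborel (E j k) (exponential_density 1)" if "j \<in> {1..l}" "1 \<le> k" for j k
    using inputs that by (simp add: pdmp_inputs_def)
  define F where "F = (\<lambda>src. case src of
      Initial \<Rightarrow> sets (vimage_algebra (space P) W (borel_on M))
    | Clock j k \<Rightarrow> sets (vimage_algebra (space P) (E j k) borel)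
    | Mark k \<Rightarrow> sets (vimage_algebra (space P) (U k) (borel_on {0..1})))"
  have indep: "indep_sets F ({Initial} \<union> {Clock j k | j k. j \<in> {1..l} \<and> 1 \<le> k} \<union> {Mark k | k. 1 \<le> k})"
    using inputs by (simp add: pdmp_inputs_def F_def)
  define B where "B src = (case src of Clock j k \<Rightarrow> {\<omega> \<in> space P. 1 < E j k \<omega>} | _ \<Rightarrow> space P)" for src
  define A where "A k = {\<omega> \<in> space P. \<forall>j\<in>{1..l}. 1 < E j (Suc k) \<omega>}" for k
  have BF: "B src \<in> F src" for src
  proof (cases src)
    case (Clock j k)
    have "E j k -` {1<..} \<inter> space P \<in> sets (vimage_algebra (space P) (E j k) borel)"
      by (rule in_vimage_algebra) simp
    also have "E j k -` {1<..} \<inter> space P = B src"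
      unfolding B_def Clock by auto
    finally show ?thesis
      unfolding F_def Clock by simp
  next
    case Initial
    then show ?thesis
      using sets.top[of "vimage_algebra (space P) W (borel_on M)"] by (simp add: B_def F_def)
  next
    case (Mark k)
    then show ?thesis
      using sets.top[of "vimage_algebra (space P) (U k) (borel_on {0..1})"] by (simp add: B_def F_def)
  qed
  have prob_B: "prob (B (Clock j k)) = exp (- 1)" if "j \<in> {1..l}" "1 \<le> k" for j k
    using exponential_distributedD_gt[OF exp[OF that], of 1] by (simp add: B_def)
  have prob_A: "prob (\<Inter>k\<in>K. A k) = (exp (- 1) ^ l) ^ card K" if K: "finite K" "K \<noteq> {}" for K
  proof -
    let ?C = "(\<lambda>(k, j). Clock j (Suc k)) ` (K \<times> {1..l})"
    have "(\<Inter>k\<in>K. A k) = (\<Inter>src\<in>insert Initial ?C. B src)"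
      using K(2) by (auto simp: A_def B_def)
    also have "prob \<dots> = (\<Prod>src\<in>insert Initial ?C. prob (B src))"
      using K(1) BF by (intro indep_setsD[OF indep]) auto
    also have "\<dots> = (\<Prod>src\<in>?C. prob (B src))"
      using K(1) by (subst prod.insert) (auto simp: B_def prob_space)
    also have "\<dots> = (\<Prod>(k, j)\<in>K \<times> {1..l}. prob (B (Clock j (Suc k))))"
      by (subst prod.reindex) (auto simp: inj_on_def case_prod_unfold)
    also have "\<dots> = (\<Prod>(k, j)\<in>K \<times> {1..l}. exp (- 1))"
      by (intro prod.cong) (auto simp: prob_B)
    also have "\<dots> = (exp (- 1) ^ l) ^ card K"
      by (simp add: card_cartesian_product power_mult mult.commute flip: power_mult)
    finally show ?thesis .
  qed
  have A_sets: "A k \<in> events" for k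
  proof -
    have "Measurable.pred P (\<lambda>\<omega>. 1 < E j (Suc k) \<omega>)" if "j \<in> {1..l}" for j
      using distributed_measurable[OF exp[OF that, of "Suc k"]] by simp
    then have "Measurable.pred P (\<lambda>\<omega>. \<forall>j\<in>{1..l}. 1 < E j (Suc k) \<omega>)"
      by (intro measurable_pred_countable) auto
    then show ?thesis
      by (simp add: A_def pred_def)
  qed
  have "indep_events A UNIV"
  proof (rule indep_eventsI)
    fix K :: "nat set" assume "finite K" "K \<noteq> {}"
    moreover have "prob (A k) = exp (- 1) ^ l" for k
      using prob_A[of "{k}"] by simp
    ultimately show "prob (\<Inter>k\<in>K. A k) = (\<Prod>k\<in>K. prob (A k))"
      by (simp add: prob_A)
  qed (use A_sets in blast)
  then have "prob (\<Inter>n. \<Union>m\<in>{n..}. A m) = 0 \<or> prob (\<Inter>n. \<Union>m\<in>{n..}. A m) = 1"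
    by (rule borel_0_1_law)
  moreover have "exp (- 1) ^ l \<le> prob (\<Inter>n. \<Union>m\<in>{n..}. A m)"
  proof (rule LIMSEQ_le_const)
    show "(\<lambda>n. prob (\<Union>m\<in>{n..}. A m)) \<longlonglongrightarrow> prob (\<Inter>n. \<Union>m\<in>{n..}. A m)"
      using A_sets by (intro finite_Lim_measure_decseq) (force simp: decseq_def)+
    have "exp (- 1) ^ l \<le> prob (\<Union>m\<in>{n..}. A m)" for n
    proof -
      have "exp (- 1) ^ l = prob (A n)"
        using prob_A[of "{n}"] by simp
      also have "\<dots> \<le> prob (\<Union>m\<in>{n..}. A m)"
        using A_sets by (intro finite_measure_mono) auto
      finally show ?thesis .
    qed
    then show "\<exists>N. \<forall>n\<ge>N. exp (- 1) ^ l \<le> prob (\<Union>m\<in>{n..}. A m)"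
      by blast
  qed
  moreover have "0 < exp (- 1 :: real) ^ l"
    by simp
  ultimately have "prob (\<Inter>n. \<Union>m\<in>{n..}. A m) = 1"
    by linarith
  then have "AE \<omega> in P. \<omega> \<in> (\<Inter>n. \<Union>m\<in>{n..}. A m)"
    using A_sets by (intro AE_prob_1)
  then show ?thesis
    by eventually_elim (force simp: A_def intro: less_imp_le)
qed

theorem proposition8:
  fixes M :: "'a::euclidean_space set"
    and \<phi> :: "real \<Rightarrow> real \<Rightarrow> 'a \<Rightarrow> 'a"
    and l :: nat
    and r :: "nat \<Rightarrow> real \<Rightarrow> 'a \<Rightarrow> real"
    and Q :: "nat \<Rightarrow> real \<Rightarrow> 'a \<Rightarrow> 'a measure"
    and G :: "nat \<Rightarrow> real \<Rightarrow> 'a \<Rightarrow> real \<Rightarrow> 'a"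
    and P :: "'w measure"
    and \<mu>0 :: "'a measure"
    and W :: "'w \<Rightarrow> 'a"
    and E :: "nat \<Rightarrow> nat \<Rightarrow> 'w \<Rightarrow> real"
    and U :: "nat \<Rightarrow> 'w \<Rightarrow> real"
  assumes "smooth_submanifold M" and "closed M"
    and "pdmp_characteristics M \<phi> l r Q"
    and "\<forall>i\<in>{1..l}. kernel_representation M (Q i) (G i)"
    and "\<mu>0 \<in> space (prob_algebra (borel_on M))"
    and "pdmp_inputs M l P \<mu>0 W E U"
  shows "non_explosive P (pdmp \<phi> l r G W E U) \<longleftrightarrow>
    (\<forall>t\<ge>0.
      ((\<lambda>K::real. measure P
          {\<omega> \<in> space P. \<forall>s\<in>{0..t}.
             pdmp \<phi> l r G W E U s \<omega> = pdmp \<phi> l (\<lambda>i t x. min K (r i t x)) G W E U s \<omega>})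
        \<longlongrightarrow> 1) at_top)"
proof -
  interpret prob_space P
    using assms(6) by (simp add: pdmp_inputs_def)
  interpret D: pdmp_driven M \<phi> l r G P W E U
    using assms(3,4,6) by (rule pdmp_inputs_driven)
  let ?X = "pdmp \<phi> l r G W E U"
  let ?Y = "\<lambda>K::real. pdmp \<phi> l (\<lambda>i t x. min K (r i t x)) G W E U"
  define A where "A t K = {\<omega> \<in> space P. \<forall>s\<in>{0..t}. ?X s \<omega> = ?Y K s \<omega>}" for t K
  have A_sets: "A t K \<in> events" if "0 \<le> K" for t K
    unfolding A_def by (rule sets_pdmp_eq[OF D.pdmp_driven_axioms D.truncated_driven[OF that]])
  have non_explosive: "non_explosive P ?X \<longleftrightarrow> (AE \<omega> in P. D.explosion \<omega> = \<infinity>)"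
    unfolding non_explosive_def by (rule AE_cong) (simp add: D.explosion_time_pdmp)
  have "((\<lambda>K. prob (A t K)) \<longlongrightarrow> 1) at_top"
    if "AE \<omega> in P. D.explosion \<omega> = \<infinity>" and t: "0 \<le> t" for t
  proof -
    have "((\<lambda>K. \<integral>\<omega>. indicat_real (A t (max 0 K)) \<omega> \<partial>P) \<longlongrightarrow> (\<integral>\<omega>. 1 \<partial>P)) at_top"
    proof (rule integral_dominated_convergence_at_top[where w = "\<lambda>_. 1"])
      show "AE \<omega> in P. ((\<lambda>K. indicat_real (A t (max 0 K)) \<omega>) \<longlongrightarrow> 1) at_top"
        using that(1) AE_space
      proof eventually_elim
        case (elim \<omega>)
        then have "ereal t < D.explosion \<omega>"
          by simp
        then have "\<forall>\<^sub>F K in at_top. \<forall>s\<in>{0..t}. ?X s \<omega> = ?Y K s \<omega>"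
          unfolding D.explosion_def D.jump_time_def pdmp_def
          using pdmp_realisation.path_truncation[OF D.realisation[OF elim(2)] t] by blast
        with eventually_ge_at_top[of 0]
        have "\<forall>\<^sub>F K in at_top. indicat_real (A t (max 0 K)) \<omega> = 1"
          by eventually_elim (use elim(2) in \<open>simp add: A_def max_absorb2\<close>)
        then show ?case
          by (rule tendsto_eventually)
      qed
    qed (use A_sets in \<open>auto simp: indicator_def intro!: always_eventually\<close>)
    then have "((\<lambda>K. prob (A t (max 0 K))) \<longlongrightarrow> 1) at_top"
      using A_sets by (simp add: prob_space)
    moreover have "\<forall>\<^sub>F K in at_top. prob (A t (max 0 K)) = prob (A t K)"
      using eventually_ge_at_top[of 0] by eventually_elim (simp add: max_absorb2)
    ultimately show ?thesis
      by (rule Lim_transform_eventually)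
  qed
  moreover have "AE \<omega> in P. D.explosion \<omega> = \<infinity>"
    if lim: "\<And>t. 0 \<le> t \<Longrightarrow> ((\<lambda>K. prob (A t K)) \<longlongrightarrow> 1) at_top"
  proof -
    have late: "AE \<omega> in P. ereal t < D.explosion \<omega>" if t: "0 \<le> t" for t
    proof -
      define N where "N = {\<omega> \<in> space P. D.explosion \<omega> \<le> ereal t}"
      have N: "N \<in> events"
        unfolding N_def by measurable
      have bound: "prob N \<le> 1 - prob (A t K)" if K: "0 < K" for K
      proof -
        interpret T: pdmp_driven M \<phi> l "\<lambda>i t x. min K (r i t x)" G P W E U
          using K by (intro D.truncated_driven) simp
        have "AE \<omega> in P. \<omega> \<in> N \<longrightarrow> \<omega> \<in> space P - A t K"
          using long_clocks_infinitely_often[OF assms(6)] AE_space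
        proof eventually_elim
          case (elim \<omega>)
          have "T.explosion \<omega> = \<infinity>"
            unfolding T.explosion_def T.jump_time_def
            by (rule pdmp_realisation.explosion_free_if_bounded_rates[OF T.realisation[OF elim(2)] K])
              (use elim(1) in auto)
          then have "?Y K t \<omega> \<noteq> None"
            using T.pdmp_None_iff[OF elim(2) t] by simp
          then show ?case
            using D.pdmp_None_iff[OF elim(2) t] t
            by (auto simp: N_def A_def intro!: bexI[of _ t])
        qed
        then have "prob N \<le> prob (space P - A t K)"
          using A_sets K by (intro finite_measure_mono_AE) auto
        then show ?thesis
          using A_sets K by (simp add: prob_compl)
      qed
      have "((\<lambda>K. 1 - prob (A t K)) \<longlongrightarrow> 1 - 1) at_top"
        by (intro tendsto_intros lim t)
      moreover have "\<forall>\<^sub>F K in at_top. prob N \<le> 1 - prob (A t K)"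
        using eventually_gt_at_top[of 0] by (rule eventually_mono) (rule bound)
      ultimately have "prob N \<le> 1 - 1"
        by (rule tendsto_lowerbound) simp
      then have "prob N = 0"
        by (simp add: measure_le_0_iff)
      then have "AE \<omega> in P. \<omega> \<notin> N"
        using N by (simp add: prob_eq_0)
      then show ?thesis
        using AE_space by eventually_elim (auto simp: N_def)
    qed
    have "AE \<omega> in P. \<forall>n::nat. ereal (real n) < D.explosion \<omega>"
      unfolding AE_all_countable using late by simp
    then show ?thesis
    proof eventually_elim
      case (elim \<omega>)
      have "ereal c \<le> D.explosion \<omega>" for c
      proof -
        obtain n where "c < real n"
          using reals_Archimedean2 by blast
        then show ?thesis
          using elim by (metis ereal_less_eq(3) less_imp_le order_trans)
      qed
      then show ?case
        by (rule ereal_top)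
    qed
  qed
  ultimately show ?thesis
    unfolding non_explosive A_def by blast
qed

end
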